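(* Let $P_n$ be the path graph on $n>2$ vertices. Then, for every $k\in\{0,1,\ldots,n\}$, $$W_{\rho_k}(P_n)=\binom{n+1}{k+1}\frac{5k^3n^2+k^3n+18k^2n^2-18k^2n-12k^2+19kn^2-25kn+12k+6n^2-6n}{6(k+2)(k+3)}.$$
   Context: $P_n$ has vertex set $\{1,\ldots,n\}$ and edges $\{i,i+1\}$. For a graph $G$, $A\subseteq V_G$ and $u,v\in V_G$, $\rho_A(u,v)$ is the minimum length of a walk in $G$ from $u$ to $v$ (vertex repetitions allowed, length $\ge0$) visiting every vertex of $A$ (so $\rho_\emptyset$ is the geodesic distance); $W_{\rho_A}(G)=\frac12\sum_{u,v\in V_G}\rho_A(u,v)$ over all ordered pairs including $u=v$; and $W_{\rho_k}(G)=\sum_{A\subseteq V_G,\ |A|=k}W_{\rho_A}(G)$. *)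

theory Defs
  imports Complex_Main "Graph_Theory.Graph_Theory"
begin

text \<open>Following the convention of the session Graph_Theory, an undirected graph is a
  symmetric digraph: each edge is represented by its two orientations.\<close>

definition path_graph :: "nat \<Rightarrow> nat pair_pre_digraph" where
  "path_graph n =
     \<lparr> pverts = {1..n},
       parcs = (\<Union>i\<in>{i. 1 \<le> i \<and> i + 1 \<le> n}. {(i, i + 1), (i + 1, i)}) \<rparr>"

lemma pair_graph_path_graph: "pair_graph (path_graph n)"
proof -
  have "parcs (path_graph n) \<subseteq> {1..n} \<times> {1..n}"
    by (auto simp: path_graph_def)
  then have "finite (parcs (path_graph n))"
    by (rule finite_subset) simp
  then show ?thesis
    by unfold_locales (auto simp: path_graph_def symmetric_def intro!: symI)
qed

text \<open>The minimum is taken over a nonempty set of lengths whenever the graph is connected,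
  \<open>u\<close> and \<open>v\<close> are vertices, and \<open>A\<close> is a finite set of vertices; otherwise
  the value may be unspecified.\<close>

definition walk_dist :: "('a, 'b) pre_digraph \<Rightarrow> 'a set \<Rightarrow> 'a \<Rightarrow> 'a \<Rightarrow> nat" where
  "walk_dist G A u v =
     (LEAST l. \<exists>p. vwalk p G \<and> hd p = u \<and> last p = v \<and> A \<subseteq> set p \<and> vwalk_length p = l)"

definition wiener_set :: "('a, 'b) pre_digraph \<Rightarrow> 'a set \<Rightarrow> real" where
  "wiener_set G A = 1 / 2 * (\<Sum>u\<in>verts G. \<Sum>v\<in>verts G. real (walk_dist G A u v))"

definition wiener_card :: "('a, 'b) pre_digraph \<Rightarrow> nat \<Rightarrow> real" where
  "wiener_card G k = (\<Sum>A\<in>{A. A \<subseteq> verts G \<and> card A = k}. wiener_set G A)"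

end

theory Submission
  imports Defs
begin

text \<open>A walk in the path that visits the least element \<open>m\<close> and the greatest element \<open>M\<close> of
  \<open>A \<union> {u, v}\<close> visits everything in between, and the cheapest such walk from \<open>u\<close> to \<open>v\<close> has
  length \<open>2 * (M - m) - \<bar>u - v\<bar>\<close>. The spread \<open>M - m\<close> counts the cuts between \<open>i\<close> and \<open>i + 1\<close> that
  separate \<open>A \<union> {u, v}\<close>. For a fixed cut, the triples \<open>(A, u, v)\<close> that are not separated lie
  entirely in one of the two sides, which gives \<open>(i choose k) * i\<^sup>2\<close> and
  \<open>((n - i) choose k) * (n - i)\<^sup>2\<close> of them; what remains is a hockey-stick summation.\<close>

section \<open>Lower bound for walk lengths in the path\<close>

lemma vwalk_nth_arc:
  assumes "vwalk p G" "Suc i < length p"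
  shows "(p ! i, p ! Suc i) \<in> arcs_ends G"
  using assms
proof (induction arbitrary: i)
  case (Base u)
  then show ?case by simp
next
  case (Cons u v es)
  then show ?case by (cases i) auto
qed

lemma parcs_path_graph:
  "(x, y) \<in> parcs (path_graph n) \<longleftrightarrow>
     x \<in> {1..n} \<and> y \<in> {1..n} \<and> (y = Suc x \<or> x = Suc y)"
  by (auto simp: path_graph_def)

lemma pverts_path_graph [simp]: "pverts (path_graph n) = {1..n}"
  by (simp add: path_graph_def)

text \<open>Every arc changes the vertex number by exactly one, so displacement is bounded by
  elapsed steps.\<close>

lemma path_graph_vwalk_lipschitz:
  assumes "vwalk p (with_proj (path_graph n))" "i \<le> j" "j < length p"
  shows "\<bar>int (p ! j) - int (p ! i)\<bar> \<le> int j - int i"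
  using assms(2,3)
proof (induction j rule: dec_induct)
  case base
  then show ?case by simp
next
  case (step j)
  have "(p ! j, p ! Suc j) \<in> parcs (path_graph n)"
    using vwalk_nth_arc[OF assms(1) step.prems] by simp
  then have "\<bar>int (p ! Suc j) - int (p ! j)\<bar> \<le> 1"
    by (auto simp: parcs_path_graph)
  with step show ?case by linarith
qed

text \<open>Visits to \<open>a\<close> and \<open>b\<close> cut the walk into three segments, each
  at least as long as the distance between its ends. The middle one gives
  \<open>\<bar>b - a\<bar>\<close>; by the triangle inequality the outer two together give at least
  \<open>\<bar>b - a\<bar> - \<bar>hd p - last p\<bar>\<close>.\<close>

lemma path_graph_vwalk_length_ge:
  assumes p: "vwalk p (with_proj (path_graph n))"
    and "a \<in> set p" "b \<in> set p"
  shows "2 * \<bar>int b - int a\<bar> - \<bar>int (hd p) - int (last p)\<bar> \<le> int (vwalk_length p)"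
proof -
  obtain i where i: "i < length p" "p ! i = a"
    using assms(2) by (auto simp: in_set_conv_nth)
  obtain j where j: "j < length p" "p ! j = b"
    using assms(3) by (auto simp: in_set_conv_nth)
  have ne: "p \<noteq> []" using p by auto
  let ?l = "length p - 1"
  have hl: "hd p = p ! 0" "last p = p ! ?l" "?l < length p"
    using ne by (auto simp: hd_conv_nth last_conv_nth)
  note lip = path_graph_vwalk_lipschitz[OF p]
  have le: "i \<le> ?l" "j \<le> ?l" using i j by auto
  have visit: "\<bar>int a - int (hd p)\<bar> \<le> int i" "\<bar>int b - int (hd p)\<bar> \<le> int j"
    "\<bar>int (last p) - int a\<bar> \<le> int ?l - int i" "\<bar>int (last p) - int b\<bar> \<le> int ?l - int j"
    using lip[of 0 i] lip[of 0 j] lip[of i ?l] lip[of j ?l] i j hl le by simp_all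
  have "\<bar>int b - int a\<bar> \<le> \<bar>int j - int i\<bar>"
    using lip[of i j] lip[of j i] i j by (cases "i \<le> j") auto
  \<comment> \<open>The first inequality serves walks that reach \<open>a\<close> before
    \<open>b\<close>, the second the opposite order.\<close>
  moreover have
    "\<bar>int b - int a\<bar> \<le> \<bar>int a - int (hd p)\<bar> + \<bar>int (hd p) - int (last p)\<bar> + \<bar>int (last p) - int b\<bar>"
    "\<bar>int b - int a\<bar> \<le> \<bar>int b - int (hd p)\<bar> + \<bar>int (hd p) - int (last p)\<bar> + \<bar>int (last p) - int a\<bar>"
    by linarith+
  moreover have "\<bar>int j - int i\<bar> = int j - int i \<or> \<bar>int j - int i\<bar> = int i - int j"
    by linarith
  ultimately have "2 * \<bar>int b - int a\<bar> - \<bar>int (hd p) - int (last p)\<bar> \<le> int ?l"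
    using visit by (elim disjE) linarith+
  then show ?thesis by simp
qed

section \<open>Optimal walks and the value of the distance\<close>

lemma path_graph_vwalk_upt:
  assumes "1 \<le> a" "a \<le> b" "b \<le> n"
  shows "vwalk [a..<Suc b] (with_proj (path_graph n))"
proof -
  have "set (vwalk_arcs [a..<Suc b]) \<subseteq> parcs (path_graph n)"
    using assms(2,3)
  proof (induction b rule: dec_induct)
    case base
    then show ?case by simp
  next
    case (step b)
    then have "set (vwalk_arcs ([a..<Suc b] @ [Suc b])) \<subseteq> parcs (path_graph n)"
      using assms(1) by (subst set_vwalk_arcs_snoc) (auto simp: parcs_path_graph)
    then show ?case using step by simp
  qed
  then show ?thesis using assms by (intro vwalkI) auto
qed

lemma path_graph_vwalk_rev:
  assumes "vwalk p (with_proj (path_graph n))"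
  shows "vwalk (rev p) (with_proj (path_graph n))"
  using assms by (auto simp: vwalk_def set_vwalk_arcs_rev parcs_path_graph subset_iff)

text \<open>If \<open>u \<le> v\<close>, walk from \<open>u\<close> down to \<open>m\<close>, sweep
  up to \<open>M\<close>, and return down to \<open>v\<close>:
  \<open>(u - m) + (M - m) + (M - v)\<close> steps. Otherwise take the mirror image, first up to
  \<open>M\<close>, then down to \<open>m\<close>, then up to \<open>v\<close>.\<close>

lemma path_graph_covering_vwalk:
  assumes "1 \<le> m" "M \<le> n" "u \<in> {m..M}" "v \<in> {m..M}"
  obtains p where "vwalk p (with_proj (path_graph n))" "hd p = u" "last p = v"
    "{m..M} \<subseteq> set p" "int (vwalk_length p) = 2 * (int M - int m) - \<bar>int u - int v\<bar>"
proof -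
  note result = that
  let ?G = "with_proj (path_graph n)"
  have up: "vwalk [a..<Suc b] ?G" and down: "vwalk (rev [a..<Suc b]) ?G"
    if "m \<le> a" "a \<le> b" "b \<le> M" for a b
    using that assms path_graph_vwalk_upt path_graph_vwalk_rev by (auto simp del: upt_Suc)
  have ends: "hd [a..<Suc b] = a" "last [a..<Suc b] = b"
    "hd (rev [a..<Suc b]) = b" "last (rev [a..<Suc b]) = a" if "a \<le> b" for a b
    using that by (auto simp: hd_rev last_rev simp del: upt_Suc simp flip: upt_Suc)
  have join: "vwalk (p @ tl q) ?G \<and> hd (p @ tl q) = hd p \<and> last (p @ tl q) = last q
      \<and> set (p @ tl q) = set p \<union> set q \<and> length (p @ tl q) = length p + length q - 1"
    if "vwalk p ?G" "vwalk q ?G" "last p = hd q" for p q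
  proof -
    have ne: "p \<noteq> []" "q \<noteq> []" using that by auto
    then have "last p \<in> set p" by simp
    then show ?thesis
      using that ne vwalk_joinI_vwalk[of p ?G q]
      by (cases q) (auto simp: joinable_def vwalk_join_def)
  qed
  \<comment> \<open>The middle piece alone covers the interval. The \<open>+ 3\<close> arises
    because each of the three vertex lists has one more vertex than arcs.\<close>
  have three: ?thesis
    if "vwalk p ?G" "vwalk q ?G" "vwalk r ?G" "last p = hd q" "last q = hd r"
      "hd p = u" "last r = v" "set q = {m..M}"
      "length p + length q + length r =
         nat (2 * (int M - int m) - \<bar>int u - int v\<bar> + 3)" for p q r
  proof -
    note 1 = join[OF that(1,2,4)]
    then have "last (p @ tl q) = hd r" using that by simp
    note 2 = join[OF conjunct1[OF 1] that(3) this]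
    \<comment> \<open>The total length is then at least 3, so neither \<open>nat\<close> nor the
      subtractions of naturals truncate.\<close>
    have "p \<noteq> []" "q \<noteq> []" "r \<noteq> []" using that by auto
    then have "length p \<ge> 1" "length q \<ge> 1" "length r \<ge> 1"
      by (simp_all add: Suc_le_eq)
    then have "int (vwalk_length ((p @ tl q) @ tl r)) = 2 * (int M - int m) - \<bar>int u - int v\<bar>"
      using that 1 2 by simp
    with 1 2 that show ?thesis by (intro result[of "(p @ tl q) @ tl r"]) auto
  qed
  show ?thesis
  proof (cases "u \<le> v")
    case True
    with assms show ?thesis
      by (intro three[of "rev [m..<Suc u]" "[m..<Suc M]" "rev [v..<Suc M]"] up down)
         (auto simp: ends simp del: upt_Suc)
  next
    case False
    with assms show ?thesis
      by (intro three[of "[u..<Suc M]" "rev [m..<Suc M]" "[m..<Suc v]"] up down)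
         (auto simp: ends simp del: upt_Suc)
  qed
qed

text \<open>The covering walk on \<open>{Min S..Max S}\<close> attains the value. Conversely, an
  admissible walk contains its endpoints \<open>u\<close> and \<open>v\<close> as well as
  \<open>A\<close>, hence both extremes of \<open>S\<close>, and the lower bound applies to
  these.\<close>

lemma walk_dist_path_graph:
  assumes "A \<subseteq> {1..n}" "u \<in> {1..n}" "v \<in> {1..n}"
  defines "S \<equiv> insert u (insert v A)"
  shows "int (walk_dist (with_proj (path_graph n)) A u v)
    = 2 * (int (Max S) - int (Min S)) - \<bar>int u - int v\<bar>"
proof -
  let ?G = "with_proj (path_graph n)"
  have fin: "finite S" "S \<noteq> {}" and sub: "S \<subseteq> {1..n}"
    using assms finite_subset[of A "{1..n}"] by auto
  have mem: "Min S \<in> S" "Max S \<in> S" using fin by auto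
  have range: "x \<in> {Min S..Max S}" if "x \<in> S" for x using fin that by auto
  have spread: "\<bar>int (Max S) - int (Min S)\<bar> = int (Max S) - int (Min S)"
    using range[OF mem(1)] by simp
  obtain p where p: "vwalk p ?G" "hd p = u" "last p = v" "{Min S..Max S} \<subseteq> set p"
      "int (vwalk_length p) = 2 * (int (Max S) - int (Min S)) - \<bar>int u - int v\<bar>"
  proof (rule path_graph_covering_vwalk)
    show "1 \<le> Min S" "Max S \<le> n" using mem sub by auto
    show "u \<in> {Min S..Max S}" "v \<in> {Min S..Max S}" by (rule range; simp add: S_def)+
  qed
  have "A \<subseteq> set p" using p(4) range by (auto simp: S_def)
  have "walk_dist ?G A u v = vwalk_length p"
    unfolding walk_dist_def
  proof (rule Least_equality)
    show "\<exists>q. vwalk q ?G \<and> hd q = u \<and> last q = v \<and> A \<subseteq> set q \<and> vwalk_length q = vwalk_length p"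
      using p \<open>A \<subseteq> set p\<close> by blast
  next
    fix l
    assume "\<exists>q. vwalk q ?G \<and> hd q = u \<and> last q = v \<and> A \<subseteq> set q \<and> vwalk_length q = l"
    then obtain q where q: "vwalk q ?G" "hd q = u" "last q = v" "A \<subseteq> set q" "vwalk_length q = l"
      by blast
    then have "q \<noteq> []" by auto
    then have "S \<subseteq> set q" using q by (auto simp: S_def)
    then have "2 * \<bar>int (Max S) - int (Min S)\<bar> - \<bar>int u - int v\<bar> \<le> int l"
      using path_graph_vwalk_length_ge[OF q(1), of "Min S" "Max S"] mem q by auto
    then have "int (vwalk_length p) \<le> int l" unfolding p(5) spread .
    then show "vwalk_length p \<le> l" by (simp only: of_nat_le_iff)
  qed
  with p(5) show ?thesis by simp
qed

section \<open>Counting by cuts\<close>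

lemma spread_eq_sum_cuts:
  assumes "S \<subseteq> {1..n}" "S \<noteq> {}"
  shows "real (Max S) - real (Min S) =
    (\<Sum>i\<in>{1..<n}. 1 - of_bool (S \<subseteq> {1..i}) - of_bool (S \<subseteq> {Suc i..n}))"
proof -
  have fin: "finite S" using assms finite_subset by blast
  then have mem: "Min S \<in> S" "Max S \<in> S" using assms by auto
  then have le: "1 \<le> Min S" "Max S \<le> n" "Min S \<le> Max S" using assms fin by auto
  have "S \<subseteq> {1..i} \<longleftrightarrow> Max S \<le> i" for i
    using assms fin by (auto simp: subset_iff)
  moreover have "S \<subseteq> {Suc i..n} \<longleftrightarrow> i < Min S" for i
    using assms fin by (auto simp: subset_iff Suc_le_eq)
  \<comment> \<open>A nonempty \<open>S\<close> cannot lie on both sides of a cut, so each summand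
    is the indicator of \<open>Min S \<le> i < Max S\<close>.\<close>
  ultimately have "(\<Sum>i\<in>{1..<n}. 1 - of_bool (S \<subseteq> {1..i}) - of_bool (S \<subseteq> {Suc i..n}))
      = (\<Sum>i\<in>{1..<n}. of_bool (i \<in> {Min S..<Max S}) :: real)"
    using le by (intro sum.cong) auto
  also have "\<dots> = real (card {Min S..<Max S})"
  proof -
    have "{1..<n} \<inter> {i. i \<in> {Min S..<Max S}} = {Min S..<Max S}" using le by auto
    then show ?thesis by (simp only: sum_of_bool_eq finite_atLeastLessThan)
  qed
  finally show ?thesis using le by (simp add: of_nat_diff)
qed

text \<open>The inclusion splits into independent conditions on \<open>A\<close>, \<open>u\<close>
  and \<open>v\<close>, so the triple sum factors into three counts.\<close>

lemma sum_of_bool_insert2_subset: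
  assumes "finite V" "B \<subseteq> V"
  shows "(\<Sum>A | A \<subseteq> V \<and> card A = k. \<Sum>u\<in>V. \<Sum>v\<in>V. of_bool (insert u (insert v A) \<subseteq> B))
    = real (card B choose k) * real (card B) ^ 2"
proof -
  have fin: "finite {A. A \<subseteq> V \<and> card A = k}" "finite B"
    using assms finite_subset by auto
  have "(\<Sum>A | A \<subseteq> V \<and> card A = k. \<Sum>u\<in>V. \<Sum>v\<in>V. of_bool (insert u (insert v A) \<subseteq> B))
    = (\<Sum>A | A \<subseteq> V \<and> card A = k. of_bool (A \<subseteq> B) *
        ((\<Sum>u\<in>V. of_bool (u \<in> B)) * (\<Sum>v\<in>V. of_bool (v \<in> B))) :: real)"
    by (auto simp: sum_product sum_distrib_left intro!: sum.cong)
  also have "\<dots> = (\<Sum>A | A \<subseteq> V \<and> card A = k. of_bool (A \<subseteq> B)) *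
      ((\<Sum>u\<in>V. of_bool (u \<in> B)) * (\<Sum>v\<in>V. of_bool (v \<in> B)))"
    by (simp add: sum_distrib_right)
  also have "(\<Sum>u\<in>V. of_bool (u \<in> B)) = real (card B)"
  proof -
    have "V \<inter> B = B" using assms by auto
    then show ?thesis using assms by simp
  qed
  also have "(\<Sum>A | A \<subseteq> V \<and> card A = k. of_bool (A \<subseteq> B)) = real (card B choose k)"
  proof -
    have "{A. A \<subseteq> V \<and> card A = k} \<inter> {A. A \<subseteq> B} = {A. A \<subseteq> B \<and> card A = k}"
      using assms by auto
    then show ?thesis using fin n_subsets[of B k] by simp
  qed
  finally show ?thesis by (simp add: power2_eq_square)
qed

section \<open>Closed forms of the sums\<close>

lemma sum_abs_diff:
  "(\<Sum>u\<in>{1..n}. \<Sum>v\<in>{1..n}. \<bar>real u - real v\<bar>) = (real n ^ 3 - real n) / 3"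
proof (induction n)
  case 0
  then show ?case by simp
next
  case (Suc n)
  have g: "2 * (\<Sum>v\<in>{1..n}. real v) = real n * (real n + 1)"
    by (induction n) (auto simp: algebra_simps)
  have a: "(\<Sum>v\<in>{1..n}. \<bar>real (Suc n) - real v\<bar>) = (\<Sum>v\<in>{1..n}. real (Suc n) - real v)"
    by (intro sum.cong) auto
  have b: "(\<Sum>u\<in>{1..n}. \<bar>real u - real (Suc n)\<bar>) = (\<Sum>v\<in>{1..n}. real (Suc n) - real v)"
    by (intro sum.cong) auto
  \<comment> \<open>The distance table gains one row and one column, equal by symmetry; their common
    corner is 0.\<close>
  have "(\<Sum>u\<in>{1..Suc n}. \<Sum>v\<in>{1..Suc n}. \<bar>real u - real v\<bar>)
    = (\<Sum>u\<in>{1..n}. \<Sum>v\<in>{1..n}. \<bar>real u - real v\<bar>)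
      + (\<Sum>u\<in>{1..n}. \<bar>real u - real (Suc n)\<bar>) + (\<Sum>v\<in>{1..n}. \<bar>real (Suc n) - real v\<bar>)"
    by (simp add: sum.distrib del: of_nat_Suc)
  also have "\<dots> = (real n ^ 3 - real n) / 3 + 2 * (\<Sum>v\<in>{1..n}. real (Suc n) - real v)"
    unfolding a b Suc.IH by simp
  also have "2 * (\<Sum>v\<in>{1..n}. real (Suc n) - real v)
      = 2 * real n * (real n + 1) - real n * (real n + 1)"
    unfolding sum_subtractf right_diff_distrib g by (simp add: algebra_simps)
  finally show ?case by (simp add: power3_eq_cube field_simps)
qed

lemma Suc_choose_Suc_absorb:
  "real (Suc n choose Suc k) * (real k + 1) = (real n + 1) * real (n choose k)"
  using arg_cong[OF Suc_times_binomial_eq[of n k], of real]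
  by (simp add: algebra_simps del: binomial_Suc_Suc)

lemma choose_Suc_absorb:
  "real (n choose Suc k) * (real k + 1) = (real n - real k) * real (n choose k)"
  using Suc_choose_Suc_absorb[of n k] by (simp add: algebra_simps)

text \<open>The quadratic factor comes from
  \<open>i^2 = (i + 1) * (i + 2) - 3 * (i + 1) + 1\<close>: absorbing \<open>i + 1\<close> and
  \<open>i + 2\<close> into \<open>i choose k\<close> leaves three hockey-stick sums, with values
  multiples of \<open>(n + 2) choose (k + 3)\<close>, \<open>(n + 1) choose (k + 2)\<close> and
  \<open>n choose (k + 1)\<close>. Once the result is known, induction on \<open>n\<close>
  suffices.\<close>

lemma sum_square_choose:
  "(\<Sum>i<n. real (i choose k) * real i ^ 2) * ((real k + 2) * (real k + 3)) =
    real (n choose Suc k) * ((real k + 1) * (real k + 2) * (real n + 1) * (real n + 2)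
      - 3 * (real k + 1) * (real k + 3) * (real n + 1) + (real k + 2) * (real k + 3))"
  (is "?S n * ?d = real (n choose Suc k) * ?q (real n)")
proof (induction n)
  case 0
  then show ?case by simp
next
  case (Suc n)
  let ?c = "real (n choose k)"
  \<comment> \<open>With the extra factor \<open>k + 1\<close>, the absorption rules express both
    sides through \<open>n choose k\<close>, leaving a polynomial identity.\<close>
  have "(real k + 1) * (?S (Suc n) * ?d)
      = (real (n choose Suc k) * (real k + 1)) * ?q (real n) + (real k + 1) * ?c * real n ^ 2 * ?d"
  proof -
    have "?S (Suc n) * ?d = ?S n * ?d + ?c * real n ^ 2 * ?d"
      by (simp add: distrib_right)
    then show ?thesis unfolding Suc.IH by (simp only: distrib_left mult_ac)
  qed
  also have "\<dots> = (real n + 1) * ?c * ?q (real n + 1)"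
    unfolding choose_Suc_absorb by algebra
  also have "\<dots> = (real k + 1) * (real (Suc n choose Suc k) * ?q (real (Suc n)))"
    unfolding Suc_choose_Suc_absorb[symmetric] by (simp add: mult_ac add_ac)
  finally show ?case by simp
qed

section \<open>Assembling the Wiener index\<close>

lemma wiener_card_path_graph:
  assumes "n \<ge> 1"
  shows "wiener_card (with_proj (path_graph n)) k =
    real (n choose k) * ((real n - 1) * real n ^ 2 - (real n ^ 3 - real n) / 6)
      - 2 * (\<Sum>i<n. real (i choose k) * real i ^ 2)"
proof -
  let ?V = "{1..n}" and ?F = "{A. A \<subseteq> {1..n} \<and> card A = k}"
  let ?b = "\<lambda>A u v B. of_bool (insert u (insert v A) \<subseteq> B) :: real"
  have cF: "card ?F = n choose k" using n_subsets[of ?V k] by simp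
  have d: "real (walk_dist (with_proj (path_graph n)) A u v) =
      2 * (\<Sum>i\<in>{1..<n}. 1 - ?b A u v {1..i} - ?b A u v {Suc i..n}) - \<bar>real u - real v\<bar>"
    if "A \<in> ?F" "u \<in> ?V" "v \<in> ?V" for A u v
  proof -
    let ?S = "insert u (insert v A)"
    have "real_of_int (int (walk_dist (with_proj (path_graph n)) A u v)) =
        2 * (real (Max ?S) - real (Min ?S)) - \<bar>real u - real v\<bar>"
      using that by (subst walk_dist_path_graph) auto
    with that spread_eq_sum_cuts[of ?S n] show ?thesis by simp
  qed
  have "wiener_card (with_proj (path_graph n)) k
    = (\<Sum>A\<in>?F. 1 / 2 * (\<Sum>u\<in>?V. \<Sum>v\<in>?V.
        2 * (\<Sum>i\<in>{1..<n}. 1 - ?b A u v {1..i} - ?b A u v {Suc i..n}) - \<bar>real u - real v\<bar>))"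
    unfolding wiener_card_def wiener_set_def using d by simp
  \<comment> \<open>The factor 1/2 cancels the 2 in front of the cut count and survives only on the
    distance term.\<close>
  also have "\<dots> = (\<Sum>A\<in>?F. \<Sum>u\<in>?V. \<Sum>v\<in>?V. \<Sum>i\<in>{1..<n}. 1 - ?b A u v {1..i} - ?b A u v {Suc i..n})
      - (\<Sum>A\<in>?F. 1 / 2 * (\<Sum>u\<in>?V. \<Sum>v\<in>?V. \<bar>real u - real v\<bar>))"
    by (simp add: sum_subtractf sum_distrib_left right_diff_distrib)
  also have "(\<Sum>A\<in>?F. 1 / 2 * (\<Sum>u\<in>?V. \<Sum>v\<in>?V. \<bar>real u - real v\<bar>))
      = real (n choose k) * ((real n ^ 3 - real n) / 6)"
    unfolding sum_abs_diff sum_constant cF by simp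
  also have "(\<Sum>A\<in>?F. \<Sum>u\<in>?V. \<Sum>v\<in>?V. \<Sum>i\<in>{1..<n}. 1 - ?b A u v {1..i} - ?b A u v {Suc i..n})
      = (\<Sum>i\<in>{1..<n}. \<Sum>A\<in>?F. \<Sum>u\<in>?V. \<Sum>v\<in>?V. 1 - ?b A u v {1..i} - ?b A u v {Suc i..n})"
    by (simp only: sum.swap[of _ "{1..<n}"])
  also have "\<dots> = (\<Sum>i\<in>{1..<n}. real (n choose k) * real n ^ 2
      - real (i choose k) * real i ^ 2 - real ((n - i) choose k) * real (n - i) ^ 2)"
  proof (intro sum.cong refl)
    fix i assume i: "i \<in> {1..<n}"
    have "(\<Sum>A\<in>?F. \<Sum>u\<in>?V. \<Sum>v\<in>?V. ?b A u v {1..i}) = real (i choose k) * real i ^ 2"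
      using sum_of_bool_insert2_subset[of ?V "{1..i}" k] i by simp
    moreover have "(\<Sum>A\<in>?F. \<Sum>u\<in>?V. \<Sum>v\<in>?V. ?b A u v {Suc i..n})
        = real ((n - i) choose k) * real (n - i) ^ 2"
      using sum_of_bool_insert2_subset[of ?V "{Suc i..n}" k] i by simp
    moreover have "(\<Sum>A\<in>?F. \<Sum>u\<in>?V. \<Sum>v\<in>?V. 1) = real (n choose k) * real n ^ 2"
      unfolding sum_constant cF by (simp add: power2_eq_square)
    ultimately show "(\<Sum>A\<in>?F. \<Sum>u\<in>?V. \<Sum>v\<in>?V. 1 - ?b A u v {1..i} - ?b A u v {Suc i..n})
        = real (n choose k) * real n ^ 2
          - real (i choose k) * real i ^ 2 - real ((n - i) choose k) * real (n - i) ^ 2"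
      unfolding sum_subtractf by simp
  qed
  also have "\<dots> = (real n - 1) * (real (n choose k) * real n ^ 2)
      - (\<Sum>i\<in>{1..<n}. real (i choose k) * real i ^ 2)
      - (\<Sum>i\<in>{1..<n}. real ((n - i) choose k) * real (n - i) ^ 2)"
    using assms by (simp add: sum_subtractf of_nat_diff)
  \<comment> \<open>Reflecting the cuts by \<open>i \<mapsto> n - i\<close> shows that right sides
    contribute as much as left sides, hence the factor 2 in the result.\<close>
  also have "(\<Sum>i\<in>{1..<n}. real ((n - i) choose k) * real (n - i) ^ 2)
      = (\<Sum>i\<in>{1..<n}. real (i choose k) * real i ^ 2)"
    by (rule sum.reindex_bij_witness[of _ "\<lambda>i. n - i" "\<lambda>i. n - i"]) auto
  \<comment> \<open>The added term \<open>i = 0\<close> vanishes through \<open>i ^ 2\<close>, even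
    for \<open>k = 0\<close>, where \<open>0 choose 0 = 1\<close>.\<close>
  also have "(\<Sum>i\<in>{1..<n}. real (i choose k) * real i ^ 2) = (\<Sum>i<n. real (i choose k) * real i ^ 2)"
    by (rule sum.mono_neutral_left) auto
  finally show ?thesis by (simp add: algebra_simps)
qed

theorem theorem5p12:
  fixes n k :: nat
  assumes "n > 2" and "k \<in> {0..n}"
  shows "wiener_card (with_proj (path_graph n)) k =
    real ((n + 1) choose (k + 1)) *
      ((5 * real k ^ 3 * real n ^ 2 + real k ^ 3 * real n
        + 18 * real k ^ 2 * real n ^ 2 - 18 * real k ^ 2 * real n - 12 * real k ^ 2
        + 19 * real k * real n ^ 2 - 25 * real k * real n + 12 * real k
        + 6 * real n ^ 2 - 6 * real n)
       / (6 * (real k + 2) * (real k + 3)))"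
proof -
  define x y c where "x = real k" and "y = real n" and "c = real (n choose k)"
  define S where "S = (\<Sum>i<n. real (i choose k) * real i ^ 2)"
  define W where "W = wiener_card (with_proj (path_graph n)) k"
  define P where "P = 5 * x ^ 3 * y ^ 2 + x ^ 3 * y + 18 * x ^ 2 * y ^ 2 - 18 * x ^ 2 * y
    - 12 * x ^ 2 + 19 * x * y ^ 2 - 25 * x * y + 12 * x + 6 * y ^ 2 - 6 * y"
  define q where "q = (x + 1) * (x + 2) * (y + 1) * (y + 2)
      - 3 * (x + 1) * (x + 3) * (y + 1) + (x + 2) * (x + 3)"
  have x: "x \<ge> 0" by (simp add: x_def)
  have S: "(x + 1) * (S * ((x + 2) * (x + 3))) = (y - x) * c * q"
  proof -
    have "(x + 1) * (S * ((x + 2) * (x + 3))) = real (n choose Suc k) * (x + 1) * q"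
      unfolding S_def x_def y_def q_def sum_square_choose by (simp only: mult_ac)
    also have "\<dots> = (y - x) * c * q"
      unfolding x_def y_def c_def choose_Suc_absorb ..
    finally show ?thesis .
  qed
  have C: "real ((n + 1) choose (k + 1)) = (y + 1) * c / (x + 1)"
    using Suc_choose_Suc_absorb[of n k] x
    unfolding x_def y_def c_def by (simp add: field_simps)
  have W: "6 * W = c * (6 * (y - 1) * y ^ 2 - (y ^ 3 - y)) - 12 * S"
    using wiener_card_path_graph[of n k] assms(1)
    unfolding W_def S_def y_def c_def by (simp add: algebra_simps diff_divide_distrib)
  \<comment> \<open>Clearing all denominators makes every term a polynomial in \<open>x\<close> and
    \<open>y\<close> times \<open>c\<close>. The polynomial is divisible by \<open>y + 1\<close>
    with quotient \<open>P\<close>, and \<open>(y + 1) * c / (x + 1)\<close> is the binomial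
    coefficient in front of the claimed formula.\<close>
  have "6 * ((x + 1) * ((x + 2) * (x + 3))) * W = 6 * W * ((x + 1) * ((x + 2) * (x + 3)))"
    by (simp only: mult_ac)
  also have "\<dots> = c * (6 * (y - 1) * y ^ 2 - (y ^ 3 - y)) * ((x + 1) * ((x + 2) * (x + 3)))
      - 12 * ((x + 1) * (S * ((x + 2) * (x + 3))))"
    unfolding W by algebra
  also have "\<dots> = (y + 1) * c * P"
    unfolding S P_def q_def by algebra
  finally have "W = (y + 1) * c / (x + 1) * (P / (6 * (x + 2) * (x + 3)))"
    using x by (simp add: divide_simps) (simp add: algebra_simps)
  then show ?thesis
    unfolding C W_def P_def x_def y_def .
qed

end
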